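(* Let $\mathbb{T}$ be a homogeneous tree of degree $q+1$ with $q\geq2$, with its canonical weighted counting measure $\tau$, and let $\mathcal{T}$ be the family of all admissible trapezoids in $\mathbb{T}$. Let $\mathrm{trpzd}$ denote the family $\{\mathcal{T}_x\}_{x\in\mathbb{T}}$ where $\mathcal{T}_x$ is the family of all admissible trapezoids containing $x$ (respectively, the family of all admissible trapezoids $T$ with $x_T=x$). Then $$\mathscr{H}^{\mathrm{trpzd}}_\tau\leq4.$$
   Context: A homogeneous tree $\mathbb{T}$ of degree $q+1$ is a connected graph without loops (cycles) in which every vertex has degree $q+1$; $\mathbb{T}$ is identified with its vertex set, and $d(x,y)$ is the length of the shortest path between $x$ and $y$. Fix a two-sided infinite geodesic $\mathfrak{g}$ in $\mathbb{T}$ (a subgraph that is itself a homogeneous tree of degree $2$) and a bijection $\mathrm{N}:\mathfrak{g}\to\mathbb{Z}$ with $d(x,y)=|\mathrm{N}(x)-\mathrm{N}(y)|$ for all $x,y\in\mathfrak{g}$. The level $\ell:\mathbb{T}\to\mathbb{Z}$ is $\ell(x):=\mathrm{N}(x')-d(x',x)$, where $x'$ is the point of $\mathfrak{g}$ closest to $x$. The measure $\tau$ is defined on all subsets of $\mathbb{T}$ by $\tau(\{x\}):=q^{\ell(x)}$. An admissible trapezoid is either a singleton $T=\{x_T\}$ (with height $h_T:=1$), or a set of the form $$T=\{x\in\mathbb{T}:\ell(x)=\ell(x_T)-d(x_T,x),\ h_T\leq\ell(x_T)-\ell(x)<2h_T\}$$ for some $x_T\in\mathbb{T}$ and some integer $h_T\geq1$.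 For a family $\mathfrak{Q}=\{\mathcal{Q}_x\}_{x\in X}$ of nonempty sets of subsets of a set $X$, with $\mathcal{Q}:=\bigcup_x\mathcal{Q}_x$, and an outer measure $\mu$ on $X$ with $0<\mu(Q)<\infty$ for every $Q\in\mathcal{Q}$, define for $F:\mathcal{Q}\to[0,\infty]$: $\mathbf{M}^{\mathfrak{Q}}_\mu F(x):=\sup_{Q\in\mathcal{Q}_x}\frac{F(Q)}{\mu(Q)}$ and $\|F\|_{\mathcal{Q}}:=\sup\{\sum_{i=1}^nF(Q_i):Q_1,\ldots,Q_n\in\mathcal{Q},\ Q_i\cap Q_j=\emptyset\text{ for }i\neq j\}$. The Hardy-Littlewood maximal constant $\mathscr{H}^{\mathfrak{Q}}_\mu$ is the smallest constant $c$ (the infimum of all finite $c>0$) such that $\mu\{x\in X:\mathbf{M}^{\mathfrak{Q}}_\mu F(x)>r\}\leq c\,r^{-1}\|F\|_{\mathcal{Q}}$ for every $r>0$ and every $F:\mathcal{Q}\to[0,\infty]$; it is $\infty$ if no such finite $c$ exists. *)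

theory Defs
  imports "HOL-Analysis.Analysis"
begin

section \<open>Homogeneous trees\<close>

definition simple_graph :: "'a set \<Rightarrow> ('a \<Rightarrow> 'a \<Rightarrow> bool) \<Rightarrow> bool" where
  "simple_graph V E \<longleftrightarrow> (\<forall>x y. E x y \<longrightarrow> x \<in> V \<and> y \<in> V) \<and> symp E \<and> irreflp E"

definition is_path :: "'a set \<Rightarrow> ('a \<Rightarrow> 'a \<Rightarrow> bool) \<Rightarrow> 'a \<Rightarrow> 'a list \<Rightarrow> 'a \<Rightarrow> bool" where
  "is_path V E x p y \<longleftrightarrow>
     p \<noteq> [] \<and> hd p = x \<and> last p = y \<and> set p \<subseteq> V \<and> distinct p \<and> successively E p"

text \<open>The closing edge runs from the last vertex back to the first; the length bound excludes
  the back-and-forth traversal of a single edge.\<close>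
definition is_cycle :: "'a set \<Rightarrow> ('a \<Rightarrow> 'a \<Rightarrow> bool) \<Rightarrow> 'a list \<Rightarrow> bool" where
  "is_cycle V E p \<longleftrightarrow>
     3 \<le> length p \<and> set p \<subseteq> V \<and> distinct p \<and> successively E p \<and> E (last p) (hd p)"

definition homogeneous_tree :: "'a set \<Rightarrow> ('a \<Rightarrow> 'a \<Rightarrow> bool) \<Rightarrow> nat \<Rightarrow> bool" where
  "homogeneous_tree V E k \<longleftrightarrow>
     simple_graph V E \<and> V \<noteq> {} \<and>
     (\<forall>x\<in>V. \<forall>y\<in>V. \<exists>p. is_path V E x p y) \<and>
     (\<nexists>p. is_cycle V E p) \<and>
     (\<forall>x\<in>V. finite {y. E x y} \<and> card {y. E x y} = k)"

definition graph_dist :: "'a set \<Rightarrow> ('a \<Rightarrow> 'a \<Rightarrow> bool) \<Rightarrow> 'a \<Rightarrow> 'a \<Rightarrow> nat" where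
  "graph_dist V E x y = (LEAST n. \<exists>p. is_path V E x p y \<and> length p = Suc n)"

definition infinite_geodesic :: "'a set \<Rightarrow> ('a \<Rightarrow> 'a \<Rightarrow> bool) \<Rightarrow> 'a set \<Rightarrow> bool" where
  "infinite_geodesic V E G \<longleftrightarrow>
     G \<subseteq> V \<and> (\<exists>F. (\<forall>x y. F x y \<longrightarrow> E x y) \<and> homogeneous_tree G F 2)"

section \<open>Level, canonical measure and admissible trapezoids\<close>

text \<open>In a tree the point of \<open>G\<close> closest to \<open>x\<close> is unique, so the choice made by
  \<^const>\<open>arg_min_on\<close> is immaterial.\<close>
definition level :: "'a set \<Rightarrow> ('a \<Rightarrow> 'a \<Rightarrow> bool) \<Rightarrow> 'a set \<Rightarrow> ('a \<Rightarrow> int) \<Rightarrow> 'a \<Rightarrow> int" where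
  "level V E G N x =
     (let x' = arg_min_on (\<lambda>y. graph_dist V E y x) G in N x' - int (graph_dist V E x' x))"

definition tree_measure ::
  "'a set \<Rightarrow> ('a \<Rightarrow> 'a \<Rightarrow> bool) \<Rightarrow> 'a set \<Rightarrow> ('a \<Rightarrow> int) \<Rightarrow> nat \<Rightarrow> 'a measure" where
  "tree_measure V E G N q = point_measure V (\<lambda>x. ennreal (real q powi level V E G N x))"

definition trapezoid ::
  "'a set \<Rightarrow> ('a \<Rightarrow> 'a \<Rightarrow> bool) \<Rightarrow> 'a set \<Rightarrow> ('a \<Rightarrow> int) \<Rightarrow> 'a \<Rightarrow> int \<Rightarrow> 'a set" where
  "trapezoid V E G N z h =
     {x \<in> V. level V E G N x = level V E G N z - int (graph_dist V E z x) \<and>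
             h \<le> level V E G N z - level V E G N x \<and>
             level V E G N z - level V E G N x < 2 * h}"

text \<open>In a tree of degree \<open>q + 1\<close> with \<open>q \<ge> 2\<close>, an admissible trapezoid \<open>T\<close> determines its
  top vertex \<open>z\<close>, which lies in \<open>T\<close> only when \<open>T = {z}\<close>.\<close>
definition trapezoids_rooted ::
  "'a set \<Rightarrow> ('a \<Rightarrow> 'a \<Rightarrow> bool) \<Rightarrow> 'a set \<Rightarrow> ('a \<Rightarrow> int) \<Rightarrow> 'a \<Rightarrow> 'a set set" where
  "trapezoids_rooted V E G N z = insert {z} {trapezoid V E G N z h | h. 1 \<le> h}"

definition trapezoids ::
  "'a set \<Rightarrow> ('a \<Rightarrow> 'a \<Rightarrow> bool) \<Rightarrow> 'a set \<Rightarrow> ('a \<Rightarrow> int) \<Rightarrow> 'a set set" where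
  "trapezoids V E G N = (\<Union>z\<in>V. trapezoids_rooted V E G N z)"

definition trapezoids_containing ::
  "'a set \<Rightarrow> ('a \<Rightarrow> 'a \<Rightarrow> bool) \<Rightarrow> 'a set \<Rightarrow> ('a \<Rightarrow> int) \<Rightarrow> 'a \<Rightarrow> 'a set set" where
  "trapezoids_containing V E G N x = {T \<in> trapezoids V E G N. x \<in> T}"

section \<open>The Hardy-Littlewood maximal constant of a family of sets\<close>

text \<open>The set functions \<open>F\<close> are total here, but only their values on the members of the family
  enter the definitions.\<close>

definition maximal_function ::
  "('a \<Rightarrow> 'a set set) \<Rightarrow> ('a set \<Rightarrow> ennreal) \<Rightarrow> ('a set \<Rightarrow> ennreal) \<Rightarrow> 'a \<Rightarrow> ennreal" where
  "maximal_function Q \<mu> F x = (SUP A \<in> Q x. F A / \<mu> A)"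

definition set_function_norm :: "'a set set \<Rightarrow> ('a set \<Rightarrow> ennreal) \<Rightarrow> ennreal" where
  "set_function_norm \<Q> F =
     Sup {(\<Sum>i=1..n. F (A i)) | (n::nat) A. (\<forall>i\<in>{1..n}. A i \<in> \<Q>) \<and> disjoint_family_on A {1..n}}"

text \<open>If no finite constant is admissible, the infimum is over the empty set and equals \<open>\<infinity>\<close>.\<close>
definition HL_constant ::
  "'a set \<Rightarrow> ('a \<Rightarrow> 'a set set) \<Rightarrow> ('a set \<Rightarrow> ennreal) \<Rightarrow> ennreal" where
  "HL_constant X Q \<mu> =
     Inf {ennreal c | c::real. 0 < c \<and>
       (\<forall>r::real. 0 < r \<longrightarrow> (\<forall>F.
          \<mu> {x \<in> X. ennreal r < maximal_function Q \<mu> F x}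
            \<le> ennreal (c / r) * set_function_norm (\<Union>x\<in>X. Q x) F))}"

end

theory Submission
  imports Defs
begin

text \<open>Every vertex has one parent (the neighbour one level up) and \<open>q\<close> children, so the \<open>q ^ k\<close>
  descendants of \<open>z\<close> of depth \<open>k\<close> have total mass \<open>q powi level z\<close>, and a trapezoid with root \<open>z\<close>
  and height \<open>h\<close> has mass \<open>h * q powi level z\<close>. From a finite family of trapezoids select a disjoint
  subfamily greedily, highest root first. A discarded trapezoid meets a selected one, \<open>T\<close>, whose
  root \<open>z\<close> is not lower; then it lies, together with its root, among the descendants of \<open>z\<close> of
  depth less than \<open>4 * h\<close>, and these have four times the mass of \<open>T\<close>.\<close>

section \<open>Paths and distances in trees\<close>

text \<open>Induction from the tail: if the new first vertex already lies on the path found,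
  everything before its occurrence is cut off. The inclusion of vertex sets lets the path avoid
  every vertex that the walk avoids.\<close>

lemma walk_to_path:
  assumes "successively E w" "w \<noteq> []"
  shows "\<exists>p. p \<noteq> [] \<and> hd p = hd w \<and> last p = last w \<and> set p \<subseteq> set w \<and> distinct p \<and> successively E p"
  using assms
proof (induction w)
  case Nil
  then show ?case by simp
next
  case (Cons x w)
  show ?case
  proof (cases "w = []")
    case True
    then show ?thesis by (intro exI[of _ "[x]"]) simp
  next
    case False
    have "successively E w"
      using Cons.prems(1) False by (simp add: successively_Cons)
    from Cons.IH[OF this False] obtain p where p: "p \<noteq> []" "hd p = hd w" "last p = last w"
      "set p \<subseteq> set w" "distinct p" "successively E p" by blast
    show ?thesis
    proof (cases "x \<in> set p")
      case True
      then obtain ys zs where "p = ys @ x # zs" by (meson split_list)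
      with p False show ?thesis
        by (intro exI[of _ "x # zs"]) (auto simp: successively_append_iff)
    next
      case F: False
      with p False Cons.prems(1) show ?thesis
        by (intro exI[of _ "x # p"]) (auto simp: successively_Cons)
    qed
  qed
qed

locale tree =
  fixes V :: "'a set" and E :: "'a \<Rightarrow> 'a \<Rightarrow> bool"
  assumes graph: "simple_graph V E"
    and connected: "\<And>x y. x \<in> V \<Longrightarrow> y \<in> V \<Longrightarrow> \<exists>p. is_path V E x p y"
    and acyclic: "\<And>p. \<not> is_cycle V E p"
begin

abbreviation "tree_path \<equiv> is_path V E"
abbreviation "d \<equiv> graph_dist V E"

lemma edge_sym: "E x y \<Longrightarrow> E y x"
  using graph by (auto simp: simple_graph_def dest: sympD)

lemma edge_in: "E x y \<Longrightarrow> x \<in> V" "E x y \<Longrightarrow> y \<in> V"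
  using graph by (auto simp: simple_graph_def)

lemma edge_neq: "E x y \<Longrightarrow> x \<noteq> y"
  using graph by (auto simp: simple_graph_def dest: irreflpD)

lemma path_Cons: "p \<noteq> [] \<Longrightarrow> tree_path x (x # p) w \<longleftrightarrow> x \<in> V \<and> x \<notin> set p \<and> E x (hd p) \<and> tree_path (hd p) p w"
  by (auto simp: is_path_def successively_Cons)

lemma path_rev: "tree_path x p y \<Longrightarrow> tree_path y (rev p) x"
  unfolding is_path_def
  by (auto simp: hd_rev last_rev edge_sym elim: successively_mono)

text \<open>Paths that separate after \<open>x\<close> enter different neighbours of
  \<open>x\<close>. Following one to \<open>y\<close> and the other back gives a walk avoiding
  \<open>x\<close>; a path extracted from it closes up through \<open>x\<close> to a cycle.\<close>

lemma path_unique: "tree_path x p y \<Longrightarrow> tree_path x p' y \<Longrightarrow> p = p'"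
proof (induction p arbitrary: x p')
  case Nil
  then show ?case by (simp add: is_path_def)
next
  case (Cons x0 p)
  then have [simp]: "x0 = x" by (simp add: is_path_def)
  obtain s' where s': "p' = x # s'"
    using Cons.prems(2) by (cases p') (auto simp: is_path_def)
  show ?case
  proof (cases "p = [] \<or> s' = []")
    case True
    with Cons.prems s' show ?thesis
      by (auto simp: is_path_def split: if_splits)
  next
    case False
    then have ne: "p \<noteq> []" "s' \<noteq> []" by auto
    have 1: "x \<in> V" "x \<notin> set p" "E x (hd p)" "tree_path (hd p) p y"
      using Cons.prems(1) path_Cons[OF ne(1)] by auto
    have 2: "x \<notin> set s'" "E x (hd s')" "tree_path (hd s') s' y"
      using Cons.prems(2) s' path_Cons[OF ne(2)] by auto
    have "hd p = hd s'"
    proof (rule ccontr)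
      assume neq: "hd p \<noteq> hd s'"
      \<comment> \<open>The vertex \<open>y\<close> is split off because \<open>p\<close> already
        ends there, so that \<open>p @ s\<close> does not repeat it at the junction.\<close>
      from path_rev[OF 2(3)] obtain s where s: "rev s' = y # s"
        by (cases "rev s'") (auto simp: is_path_def)
      let ?w = "p @ s"
      have p: "successively E p" "last p = y" "set p \<subseteq> V" using 1(4) by (auto simp: is_path_def)
      have s'1: "successively E (y # s)" "last (y # s) = hd s'" "set (y # s) \<subseteq> V"
        using path_rev[OF 2(3)] s by (auto simp: is_path_def)
      have "set (y # s) = set s'" using s by (metis set_rev)
      then have ss: "x \<notin> set ?w" using 1(2) 2(1) by auto
      have "successively E ?w"
        using p s'1 by (auto simp: successively_append_iff successively_Cons)
      moreover have "last ?w = hd s'" using p(2) s'1(2) ne by (auto split: if_splits)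
      ultimately obtain c where c: "c \<noteq> []" "hd c = hd p" "last c = hd s'" "set c \<subseteq> set ?w"
        "distinct c" "successively E c"
        using walk_to_path[of E ?w] ne by auto
      \<comment> \<open>Distinct end points give \<open>c\<close> two vertices, and \<open>x\<close>
        is the third that \<open>is_cycle\<close> demands.\<close>
      have "length c \<ge> 2" using c(1,2,3) neq by (cases c rule: remdups_adj.cases) auto
      moreover have "set c \<subseteq> V" using c(4) p(3) s'1(3) by auto
      moreover have "x \<notin> set c" using c(4) ss by auto
      ultimately have "is_cycle V E (x # c)"
        using c 1 2(2) edge_sym by (auto simp: is_cycle_def successively_Cons)
      then show False using acyclic by blast
    qed
    with Cons.IH[OF 1(4)] 2(3) s' show ?thesis by simp
  qed
qed

section \<open>Distances and neighbours\<close>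

lemma dist_eq: "tree_path x p y \<Longrightarrow> d x y = length p - 1"
  unfolding graph_dist_def
proof (rule Least_equality)
  assume p: "tree_path x p y"
  then show "\<exists>p'. tree_path x p' y \<and> length p' = Suc (length p - 1)"
    by (intro exI[of _ p]) (auto simp: is_path_def)
  \<comment> \<open>By uniqueness of paths the minimum runs over a single length.\<close>
  show "length p - 1 \<le> n" if "\<exists>p'. tree_path x p' y \<and> length p' = Suc n" for n
    using that path_unique[OF p] by fastforce
qed

lemma dist_sym: "x \<in> V \<Longrightarrow> y \<in> V \<Longrightarrow> d x y = d y x"
  using connected dist_eq path_rev by (metis length_rev)

lemma dist_eq_0_iff:
  assumes "x \<in> V" "y \<in> V"
  shows "d x y = 0 \<longleftrightarrow> x = y"
proof -
  obtain p where p: "tree_path x p y" using connected assms by blast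
  show ?thesis
  proof
    assume "x = y"
    with assms have "tree_path x [x] y" by (auto simp: is_path_def)
    from dist_eq[OF this] show "d x y = 0" by simp
  next
    assume "d x y = 0"
    with dist_eq[OF p] p show "x = y"
      by (cases p) (auto simp: is_path_def)
  qed
qed

text \<open>If \<open>y\<close> lies on \<open>p\<close>, the rest of \<open>p\<close> from
  \<open>y\<close> on, preceded by \<open>x\<close>, is again a path to \<open>w\<close>, hence all
  of \<open>p\<close>. Otherwise \<open>y\<close> can be put in front.\<close>

lemma path_neighbour:
  assumes p: "tree_path x p w" and e: "E x y"
  shows "(\<exists>r. p = x # y # r \<and> tree_path y (y # r) w) \<or> tree_path y (y # p) w"
proof (cases "y \<in> set p")
  case True
  then obtain us r where p': "p = us @ y # r" by (meson split_list)
  with p edge_neq[OF e] have "us \<noteq> []" by (auto simp: is_path_def)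
  with p p' have x: "x \<in> set us" by (auto simp: is_path_def hd_append)
  have 1: "tree_path y (y # r) w" using p p' by (auto simp: is_path_def successively_append_iff)
  moreover have "x \<notin> set (y # r)" using p x unfolding p' is_path_def by auto
  ultimately have "tree_path x (x # y # r) w" using e edge_in path_Cons[of "y # r"] by auto
  then show ?thesis using path_unique p 1 by blast
next
  case False
  have ne: "p \<noteq> []" "hd p = x" using p by (auto simp: is_path_def)
  show ?thesis
    using path_Cons[OF ne(1), of y w] ne p e edge_in edge_sym False by auto
qed

lemma dist_neighbour:
  assumes "E x y" "w \<in> V"
  shows "d x w = d y w + 1 \<or> d y w = d x w + 1"
proof -
  obtain p where p: "tree_path x p w" using connected assms edge_in by blast
  then have "p \<noteq> []" by (auto simp: is_path_def)
  with path_neighbour[OF p assms(1)] p show ?thesis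
    by (auto dest!: dist_eq)
qed

text \<open>A neighbour closer to \<open>w\<close> must be the second vertex of the only path from
  \<open>x\<close> to \<open>w\<close>.\<close>

lemma closer_neighbour_unique:
  assumes "E x y" "E x y'" "w \<in> V" "d x w = d y w + 1" "d x w = d y' w + 1"
  shows "y = y'"
proof -
  obtain p where p: "tree_path x p w" using connected assms edge_in by blast
  then have "p \<noteq> []" by (auto simp: is_path_def)
  have "\<exists>r. p = x # u # r" if "E x u" "d x w = d u w + 1" for u
    using path_neighbour[OF p that(1)] p that(2) \<open>p \<noteq> []\<close> by (auto dest!: dist_eq)
  from this[OF assms(1,4)] this[OF assms(2,5)] show ?thesis by auto
qed

lemma closer_neighbour_exists:
  assumes "x \<in> V" "w \<in> V" "x \<noteq> w"
  shows "\<exists>y. E x y \<and> d x w = d y w + 1"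
proof -
  obtain p where p: "tree_path x p w" using connected assms by blast
  then obtain r where r: "p = x # r" by (cases p) (auto simp: is_path_def)
  with p assms have "r \<noteq> []" by (auto simp: is_path_def)
  with p path_Cons[OF this] have "E x (hd r)" "tree_path (hd r) r w" unfolding r by auto
  with dist_eq[OF p] dist_eq[of "hd r" r w] \<open>r \<noteq> []\<close> r show ?thesis
    by (intro exI[of _ "hd r"]) (cases r, auto)
qed

lemma dist_1_edge:
  assumes "x \<in> V" "w \<in> V" "d x w = 1"
  shows "E x w"
proof -
  have "x \<noteq> w" using assms dist_eq_0_iff[of x w] by auto
  then obtain y where "E x y" "d y w = 0" using closer_neighbour_exists assms by force
  then show ?thesis using dist_eq_0_iff edge_in assms by blast
qed

end

section \<open>Levels, parents and descendants\<close>

locale based_tree = tree V E for V :: "'a set" and E +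
  fixes G :: "'a set" and N :: "'a \<Rightarrow> int" and q :: nat
  assumes q: "2 \<le> q"
    and degree: "\<And>x. x \<in> V \<Longrightarrow> finite {y. E x y} \<and> card {y. E x y} = q + 1"
    and G_sub: "G \<subseteq> V"
    and N_bij: "bij_betw N G UNIV"
    and N_dist: "\<And>x y. x \<in> G \<Longrightarrow> y \<in> G \<Longrightarrow> int (d x y) = \<bar>N x - N y\<bar>"
begin

abbreviation "lev \<equiv> level V E G N"

definition geo :: "int \<Rightarrow> 'a" where "geo = inv_into G N"

lemma geo_G: "geo n \<in> G"
  unfolding geo_def using N_bij by (auto simp: bij_betw_def intro: inv_into_into)

lemma geo_V: "geo n \<in> V"
  using geo_G G_sub by blast

lemma N_geo: "N (geo n) = n"
  unfolding geo_def using N_bij by (auto simp: bij_betw_def f_inv_into_f)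

lemma geo_N: "x \<in> G \<Longrightarrow> geo (N x) = x"
  unfolding geo_def using N_bij by (auto simp: bij_betw_def)

lemma geo_edge: "E (geo n) (geo (n + 1))"
  using dist_1_edge[OF geo_V geo_V] N_dist[OF geo_G geo_G, of n "n + 1"] by (simp add: N_geo)

lemma geo_inj: "geo m = geo n \<longleftrightarrow> m = n"
  using N_geo by metis

text \<open>The distance to \<open>x\<close> has no local maximum along the geodesic, since a vertex has only one
  neighbour closer to \<open>x\<close>. So it increases by one at each step away from the point nearest to \<open>x\<close>.\<close>

lemma level_eventually:
  assumes "x \<in> V"
  shows "eventually (\<lambda>n. lev x = n - int (d x (geo n))) at_top"
proof -
  define x' where "x' = arg_min_on (\<lambda>y. d y x) G"
  have x': "x' \<in> G" "\<And>y. y \<in> G \<Longrightarrow> d x' x \<le> d y x"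
    using arg_min_nat_lemma[of "\<lambda>y. y \<in> G" "geo 0" "\<lambda>y. d y x"] geo_G
    by (auto simp: x'_def arg_min_on_def)
  define m where "m = N x'"
  have gm: "geo m = x'" using geo_N x' m_def by simp
  have step: "d (geo (m + int k + 1)) x = d (geo (m + int k)) x + 1" for k
  proof (induction k)
    case 0
    show ?case
      using dist_neighbour[OF geo_edge \<open>x \<in> V\<close>, of m] x'(2)[OF geo_G, of "m + 1"] by (auto simp: gm)
  next
    case (Suc k)
    let ?a = "geo (m + int k)" and ?b = "geo (m + int k + 1)" and ?c = "geo (m + int k + 1 + 1)"
    have "E ?b ?a" "E ?b ?c" using geo_edge edge_sym by blast+
    moreover have "?a \<noteq> ?c" using geo_inj by auto
    ultimately have "d ?b x \<noteq> d ?c x + 1"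
      using closer_neighbour_unique[of ?b ?a ?c x] Suc \<open>x \<in> V\<close> by auto
    with dist_neighbour[OF geo_edge \<open>x \<in> V\<close>, of "m + int k + 1"]
    show ?case by (auto simp: algebra_simps)
  qed
  have "d (geo (m + int k)) x = d x' x + k" for k
  proof (induction k)
    case (Suc k)
    then show ?case using step[of k] by (simp add: algebra_simps)
  qed (simp add: gm)
  then have "lev x = (m + int k) - int (d x (geo (m + int k)))" for k
    using dist_sym[OF geo_V assms]
    by (simp add: level_def Let_def x'_def[symmetric] m_def)
  then have "lev x = n - int (d x (geo n))" if "n \<ge> m" for n
    using that by (metis zle_iff_zadd)
  then show ?thesis unfolding eventually_at_top_linorder by blast
qed

text \<open>The level formula holds far up the geodesic, simultaneously for \<open>x\<close> and its
  finitely many neighbours. Around \<open>x\<close>, going up a level thus means approaching one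
  vertex \<open>w\<close>.\<close>

lemma level_common_point:
  assumes "x \<in> V"
  shows "\<exists>w\<in>V. \<exists>n. x \<noteq> w \<and> (\<forall>y. y = x \<or> E x y \<longrightarrow> lev y = n - int (d y w))"
proof -
  let ?S = "insert x {y. E x y}"
  have S: "finite ?S" "?S \<subseteq> V" using degree assms edge_in by auto
  then have "eventually (\<lambda>n. \<forall>y\<in>?S. lev y = n - int (d y (geo n))) at_top"
    by (intro eventually_ball_finite) (auto intro: level_eventually)
  \<comment> \<open>A coordinate above \<open>lev x\<close> makes the distance from \<open>x\<close>
    to \<open>geo n\<close> positive, which keeps \<open>w\<close> different from
    \<open>x\<close>.\<close>
  then have "eventually (\<lambda>n. n > lev x \<and> (\<forall>y\<in>?S. lev y = n - int (d y (geo n)))) at_top"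
    using eventually_gt_at_top[of "lev x"] by (rule eventually_conj[rotated])
  then obtain n where n: "n > lev x" "\<forall>y\<in>?S. lev y = n - int (d y (geo n))"
    unfolding eventually_at_top_linorder by blast
  have "lev x = n - int (d x (geo n))" using n(2) by blast
  then have "x \<noteq> geo n" using dist_eq_0_iff[OF assms geo_V, of n] n(1) by linarith
  moreover have "\<forall>y. y = x \<or> E x y \<longrightarrow> lev y = n - int (d y (geo n))" using n(2) by blast
  ultimately show ?thesis using geo_V by blast
qed

lemma level_edge: "E x y \<Longrightarrow> lev y = lev x + 1 \<or> lev x = lev y + 1"
proof -
  assume e: "E x y"
  obtain w n where w: "w \<in> V" "\<And>y. y = x \<or> E x y \<Longrightarrow> lev y = n - int (d y w)"
    using level_common_point[OF edge_in(1)[OF e]] by blast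
  from w(2)[of x] w(2)[of y] dist_neighbour[OF e w(1)] e show ?thesis by force
qed

text \<open>The neighbours one level up are those closer to \<open>w\<close>, and the first step of
  the path to \<open>w\<close> is the only such neighbour.\<close>

lemma parent_ex1:
  assumes "x \<in> V"
  shows "\<exists>!y. E x y \<and> lev y = lev x + 1"
proof -
  obtain w n where w: "w \<in> V" "x \<noteq> w" "\<And>y. y = x \<or> E x y \<Longrightarrow> lev y = n - int (d y w)"
    using level_common_point[OF assms] by blast
  have iff: "E x y \<and> lev y = lev x + 1 \<longleftrightarrow> E x y \<and> d x w = d y w + 1" for y
    using w(3)[of x] w(3)[of y] by auto
  show ?thesis unfolding iff
    using closer_neighbour_exists[OF assms w(1,2)] closer_neighbour_unique[OF _ _ w(1)] by blast
qed

definition parent :: "'a \<Rightarrow> 'a" where "parent x = (THE y. E x y \<and> lev y = lev x + 1)"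

lemma parent: "x \<in> V \<Longrightarrow> E x (parent x)" "x \<in> V \<Longrightarrow> lev (parent x) = lev x + 1"
  using theI'[OF parent_ex1, of x] by (simp_all add: parent_def)

lemma parent_in: "x \<in> V \<Longrightarrow> parent x \<in> V"
  by (rule edge_in(2)[OF parent(1)])

lemma parent_eqI: "E x y \<Longrightarrow> lev y = lev x + 1 \<Longrightarrow> parent x = y"
  unfolding parent_def by (intro the1_equality parent_ex1 conjI) (auto intro: edge_in)

lemma level_Lipschitz: "x \<in> V \<Longrightarrow> z \<in> V \<Longrightarrow> lev z \<le> lev x + int (d x z)"
proof (induction "d x z" arbitrary: x)
  case 0
  then have "x = z" using dist_eq_0_iff[of x z] by simp
  then show ?case by simp
next
  case (Suc k)
  then have "x \<noteq> z" using dist_eq_0_iff[of x z] by auto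
  then obtain y where y: "E x y" "d x z = d y z + 1"
    using closer_neighbour_exists Suc by blast
  have "k = d y z" using y(2) Suc.hyps(2) by simp
  then have "lev z \<le> lev y + int (d y z)"
    using Suc.hyps(1) edge_in(2)[OF y(1)] Suc.prems(2) by blast
  with level_edge[OF y(1)] y(2) show ?case by linarith
qed

text \<open>Equality in the Lipschitz bound forces every edge of the path from \<open>x\<close> to
  \<open>z\<close> upwards, so each step goes to a parent. This turns the distance condition in
  \<open>trapezoid\<close> into descent.\<close>

lemma level_dist_iff_ancestor:
  "x \<in> V \<Longrightarrow> z \<in> V \<Longrightarrow> lev x = lev z - int (d z x) \<and> d z x = k \<longleftrightarrow> (parent ^^ k) x = z"
proof (induction k arbitrary: x)
  case 0
  then show ?case using dist_eq_0_iff[of z x] by auto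
next
  case (Suc k)
  note sym = dist_sym[OF Suc.prems] dist_sym[OF parent_in[OF Suc.prems(1)] Suc.prems(2)]
  note IH = Suc.IH[OF parent_in[OF Suc.prems(1)] Suc.prems(2)]
  have f: "(parent ^^ Suc k) x = (parent ^^ k) (parent x)" by (simp add: funpow_swap1)
  show ?case
  proof
    assume a: "lev x = lev z - int (d z x) \<and> d z x = Suc k"
    then have "x \<noteq> z" by auto
    then obtain y where y: "E x y" "d x z = d y z + 1"
      using closer_neighbour_exists Suc.prems by blast
    \<comment> \<open>Had the first edge gone down, the remaining \<open>k\<close> edges could not
      climb to the level of \<open>z\<close>.\<close>
    then have "lev z \<le> lev y + int (d y z)" using level_Lipschitz edge_in Suc.prems by blast
    then have "lev y = lev x + 1" using level_edge[OF y(1)] a y(2) sym(1) by linarith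
    then have py: "parent x = y" using parent_eqI y(1) by blast
    have "d z y = k" using sym[unfolded py] a y(2) by linarith
    moreover have "lev y = lev z - int (d z y)"
      using \<open>lev y = lev x + 1\<close> a \<open>d z y = k\<close> by linarith
    ultimately show "(parent ^^ Suc k) x = z"
      using IH unfolding f py by blast
  next
    assume "(parent ^^ Suc k) x = z"
    with IH have "lev (parent x) = lev z - int (d z (parent x)) \<and> d z (parent x) = k"
      unfolding f by blast
    \<comment> \<open>Being \<open>k + 1\<close> levels below \<open>z\<close>, the vertex
      \<open>x\<close> is at distance at least \<open>k + 1\<close>, so of the two distances
      possible next to its parent only \<open>k + 1\<close> remains.\<close>
    with level_Lipschitz[OF Suc.prems] dist_neighbour[OF parent(1)[OF Suc.prems(1)] Suc.prems(2)]
      parent(2)[OF Suc.prems(1)] sym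
    show "lev x = lev z - int (d z x) \<and> d z x = Suc k" by linarith
  qed
qed

section \<open>Generations of descendants\<close>

definition descendants :: "nat \<Rightarrow> 'a \<Rightarrow> 'a set" where
  "descendants k z = {x \<in> V. (parent ^^ k) x = z}"

lemma descendants_subset: "descendants k z \<subseteq> V"
  by (auto simp: descendants_def)

lemma descendants_0: "z \<in> V \<Longrightarrow> descendants 0 z = {z}"
  by (auto simp: descendants_def)

lemma descendants_Suc: "descendants (Suc k) z = (\<Union>x\<in>descendants k z. descendants 1 x)"
  by (auto simp: descendants_def funpow_swap1 parent_in)

lemma descendants_trans:
  "x \<in> descendants j y \<Longrightarrow> y \<in> descendants k z \<Longrightarrow> x \<in> descendants (k + j) z"
  by (simp add: descendants_def funpow_add)

lemma ancestor_in: "x \<in> V \<Longrightarrow> (parent ^^ k) x \<in> V"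
  by (induction k) (auto simp: parent_in)

lemma level_descendants: "x \<in> descendants k z \<Longrightarrow> lev x = lev z - int k"
  using level_dist_iff_ancestor[of x z k] ancestor_in[of x k] by (auto simp: descendants_def)

text \<open>Every neighbour other than the parent is one level lower, so its own parent is
  \<open>x\<close>; of \<open>q + 1\<close> neighbours \<open>q\<close> are left.\<close>

lemma card_children:
  assumes "x \<in> V"
  shows "finite (descendants 1 x) \<and> card (descendants 1 x) = q"
proof -
  have "descendants 1 x = {y. E x y} - {parent x}"
  proof (intro set_eqI iffI)
    fix y assume "y \<in> descendants 1 x"
    then have y: "y \<in> V" "parent y = x" by (auto simp: descendants_def)
    with parent[OF y(1)] parent(2)[OF assms] edge_sym show "y \<in> {y. E x y} - {parent x}"
      by auto
  next
    fix y assume y: "y \<in> {y. E x y} - {parent x}"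
    then have "lev x = lev y + 1" using level_edge[of x y] parent_eqI by auto
    then show "y \<in> descendants 1 x"
      using parent_eqI[of y x] y edge_sym edge_in by (auto simp: descendants_def)
  qed
  then show ?thesis using degree[OF assms] parent(1)[OF assms] by simp
qed

lemma card_descendants: "z \<in> V \<Longrightarrow> finite (descendants k z) \<and> card (descendants k z) = q ^ k"
proof (induction k)
  case 0
  then show ?case by (simp add: descendants_0)
next
  case (Suc k)
  have "card (\<Union>x\<in>descendants k z. descendants 1 x) = (\<Sum>x\<in>descendants k z. card (descendants 1 x))"
    by (rule card_UN_disjoint)
      (use Suc card_children descendants_subset in \<open>auto simp: descendants_def\<close>)
  also have "\<dots> = (\<Sum>x\<in>descendants k z. q)"
    by (rule sum.cong) (use card_children descendants_subset in auto)
  finally show ?case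
    using Suc card_children descendants_subset unfolding descendants_Suc by fastforce
qed

section \<open>Mass of generations\<close>

abbreviation "\<tau> \<equiv> tree_measure V E G N q"

lemma emeasure_finite:
  "finite A \<Longrightarrow> A \<subseteq> V \<Longrightarrow> emeasure \<tau> A = (\<Sum>x\<in>A. ennreal (real q powi lev x))"
  unfolding tree_measure_def by (intro emeasure_point_measure_finite2) auto

text \<open>Each step down divides the weight of a vertex by \<open>q\<close> and multiplies the
  number of vertices by \<open>q\<close>.\<close>

lemma emeasure_generation:
  assumes "z \<in> V"
  shows "emeasure \<tau> (descendants k z) = ennreal (real q powi lev z)"
proof -
  have "emeasure \<tau> (descendants k z) = (\<Sum>x\<in>descendants k z. ennreal (real q powi (lev z - int k)))"
    using card_descendants[OF assms] descendants_subset
    by (subst emeasure_finite) (auto intro!: sum.cong simp: level_descendants)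
  also have "\<dots> = ennreal (real q ^ k * real q powi (lev z - int k))"
    using card_descendants[OF assms] by (simp add: ennreal_mult ennreal_of_nat_eq_real_of_nat)
  also have "real q ^ k * real q powi (lev z - int k) = real q powi lev z"
    using q by (simp add: power_int_diff)
  finally show ?thesis .
qed

text \<open>Distinct depths mean distinct levels, so the generations are disjoint. A general
  \<open>K\<close> serves the trapezoids as well as the larger sets that cover them.\<close>

lemma emeasure_generations:
  assumes "z \<in> V" "finite K"
  shows "emeasure \<tau> (\<Union>k\<in>K. descendants k z) = of_nat (card K) * ennreal (real q powi lev z)"
proof -
  have "disjoint_family_on (\<lambda>k. descendants k z) K"
    unfolding disjoint_family_on_def
  proof (intro ballI impI equals0I)
    fix j k x assume "j \<noteq> k" "x \<in> descendants j z \<inter> descendants k z"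
    then show False using level_descendants[of x j z] level_descendants[of x k z] by simp
  qed
  then have "emeasure \<tau> (\<Union>k\<in>K. descendants k z) = (\<Sum>k\<in>K. emeasure \<tau> (descendants k z))"
    using assms descendants_subset
    by (intro sum_emeasure[symmetric]) (auto simp: tree_measure_def sets_point_measure)
  then show ?thesis using assms by (simp add: emeasure_generation)
qed

section \<open>Countability and exhaustion by finite sets\<close>

lemma level_geo: "lev (geo n) = n"
proof -
  \<comment> \<open>With \<open>m \<ge> n\<close> the absolute value in \<open>N_dist\<close> is
    \<open>m - n\<close>.\<close>
  obtain m where "m \<ge> n" "lev (geo n) = m - int (d (geo n) (geo m))"
    using eventually_happens'[OF _ eventually_conj[OF eventually_ge_at_top[of n] level_eventually[OF geo_V[of n]]]]
    by auto
  then show ?thesis using N_dist[OF geo_G geo_G, of n m] by (simp add: N_geo)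
qed

text \<open>For large \<open>n\<close> the level formula says that \<open>x\<close> descends from
  \<open>geo n\<close>; there are countably many \<open>n\<close> and depths, and each generation is
  finite.\<close>

lemma countable_vertices: "countable V"
proof (rule countable_subset)
  show "V \<subseteq> (\<Union>n k. descendants k (geo n))"
  proof
    fix x assume x: "x \<in> V"
    then obtain n where "lev x = n - int (d x (geo n))"
      using level_eventually[OF x] unfolding eventually_at_top_linorder by blast
    then have "(parent ^^ d (geo n) x) x = geo n"
      using level_dist_iff_ancestor[OF x geo_V, of n "d (geo n) x"] level_geo[of n]
        dist_sym[OF x geo_V, of n] by simp
    with x show "x \<in> (\<Union>n k. descendants k (geo n))" by (auto simp: descendants_def)
  qed
  show "countable (\<Union>n k. descendants k (geo n))"
    by (intro countable_UN countableI_type countable_finite)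
      (use card_descendants[OF geo_V] in blast)
qed

text \<open>The greedy selection handles finite families, whereas a superlevel set may be infinite.
  Countability exhausts it by increasing finite sets, along which the measure is continuous.\<close>

lemma emeasure_le_finite_subsets:
  assumes A: "A \<subseteq> V" and le: "\<And>K. finite K \<Longrightarrow> K \<subseteq> A \<Longrightarrow> emeasure \<tau> K \<le> c"
  shows "emeasure \<tau> A \<le> c"
proof (cases "A = {}")
  case False
  have "countable A" using countable_subset[OF A countable_vertices] .
  then have A': "A = (\<Union>n. from_nat_into A ` {..n})"
    using range_from_nat_into[OF False] by (simp add: image_UN[symmetric] UN_atMost_UNIV)
  have sub: "from_nat_into A ` {..n} \<subseteq> A" for n using from_nat_into[OF False] by auto
  have "emeasure \<tau> A = (SUP n. emeasure \<tau> (from_nat_into A ` {..n}))"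
    by (subst A', rule SUP_emeasure_incseq[symmetric])
      (use sub A in \<open>auto simp: tree_measure_def sets_point_measure incseq_def\<close>)
  also have "\<dots> \<le> c" by (intro SUP_least le sub) auto
  finally show ?thesis .
qed (use le in simp)

section \<open>Trapezoids and the covering argument\<close>

text \<open>The conditions on the set \<open>K\<close> of depths hold both for the trapezoids, where \<open>K = {h..<2 * h}\<close>,
  and for the singletons, where \<open>K = {0}\<close> and \<open>h = 1\<close>.\<close>

definition trapezoid_at :: "'a \<Rightarrow> nat \<Rightarrow> 'a set \<Rightarrow> bool" where
  "trapezoid_at z h T \<longleftrightarrow> z \<in> V \<and>
     (\<exists>K. h \<noteq> 0 \<and> card K = h \<and> K \<subseteq> {..<2 * h} \<and> (\<forall>b\<in>K. \<forall>c\<in>K. c \<le> 2 * b) \<and>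
       T = (\<Union>k\<in>K. descendants k z))"

text \<open>By \<open>level_dist_iff_ancestor\<close> the distance condition picks out the
  descendants of \<open>z\<close>, and the drop in level is the depth.\<close>

lemma trapezoid_eq:
  assumes "z \<in> V" "1 \<le> h"
  shows "trapezoid V E G N z h = (\<Union>k\<in>{nat h..<2 * nat h}. descendants k z)"
proof -
  have iff: "lev x = lev z - int (d z x) \<longleftrightarrow> x \<in> descendants (d z x) z" if "x \<in> V" for x
    using level_dist_iff_ancestor[OF that assms(1), of "d z x"] that by (simp add: descendants_def)
  have eq: "d z x = k" if "x \<in> descendants k z" for x k
    using that level_dist_iff_ancestor[of x z k] assms(1) by (simp add: descendants_def)
  show ?thesis
  proof (intro set_eqI iffI)
    fix x assume "x \<in> trapezoid V E G N z h"
    then have x: "x \<in> V" "lev x = lev z - int (d z x)" "h \<le> lev z - lev x" "lev z - lev x < 2 * h"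
      by (auto simp: trapezoid_def)
    then have "d z x \<in> {nat h..<2 * nat h}" by auto
    with x iff show "x \<in> (\<Union>k\<in>{nat h..<2 * nat h}. descendants k z)" by blast
  next
    fix x assume "x \<in> (\<Union>k\<in>{nat h..<2 * nat h}. descendants k z)"
    then obtain k where k: "nat h \<le> k" "k < 2 * nat h" "x \<in> descendants k z" by auto
    with eq[OF k(3)] level_descendants[OF k(3)] descendants_subset assms
    show "x \<in> trapezoid V E G N z h" by (auto simp: trapezoid_def)
  qed
qed

lemma trapezoids_rooted_at:
  assumes "z \<in> V" "T \<in> trapezoids_rooted V E G N z"
  shows "\<exists>h. trapezoid_at z h T"
proof (cases "T = {z}")
  case True
  with assms show ?thesis
    by (intro exI[of _ 1]) (auto simp: trapezoid_at_def descendants_0 intro!: exI[of _ "{0}"])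
next
  case False
  with assms obtain h where h: "1 \<le> h" "T = trapezoid V E G N z h"
    by (auto simp: trapezoids_rooted_def)
  with assms trapezoid_eq[OF assms(1) h(1)] show ?thesis
    by (intro exI[of _ "nat h"])
      (auto simp: trapezoid_at_def intro!: exI[of _ "{nat h..<2 * nat h}"])
qed

lemma emeasure_trapezoid_at:
  "trapezoid_at z h T \<Longrightarrow> emeasure \<tau> T = of_nat h * ennreal (real q powi lev z)"
  \<comment> \<open>An infinite set has \<open>card\<close> 0 by default, so
    \<open>card K = h\<close> with \<open>h \<noteq> 0\<close> makes \<open>K\<close>
    finite.\<close>
  unfolding trapezoid_at_def using emeasure_generations by (metis card.infinite)

text \<open>The mass is positive. In the greedy selection this lets a selected trapezoid count as
  meeting itself.\<close>

lemma trapezoid_at_nonempty: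
  assumes "trapezoid_at z h T"
  shows "T \<noteq> {}"
proof -
  have "emeasure \<tau> T \<noteq> 0"
    using emeasure_trapezoid_at[OF assms] assms q by (auto simp: trapezoid_at_def)
  then show ?thesis by auto
qed

text \<open>A common point has depth \<open>a\<close> below \<open>z\<close> and \<open>b\<close>
  below \<open>z'\<close>. As \<open>z'\<close> is not higher, \<open>b \<le> a\<close>, and
  uniqueness of ancestors puts \<open>z'\<close> at depth \<open>a - b\<close> below
  \<open>z\<close>.\<close>

lemma overlapping_trapezoids:
  assumes T: "trapezoid_at z h T" and T': "trapezoid_at z' h' T'"
    and meet: "T \<inter> T' \<noteq> {}" and lev: "lev z' \<le> lev z"
  shows "insert z' T' \<subseteq> (\<Union>k<4 * h. descendants k z)"
proof -
  obtain K where K: "K \<subseteq> {..<2 * h}" "T = (\<Union>k\<in>K. descendants k z)"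
    using T by (auto simp: trapezoid_at_def)
  obtain K' where K': "\<And>b c. b \<in> K' \<Longrightarrow> c \<in> K' \<Longrightarrow> c \<le> 2 * b"
    "T' = (\<Union>k\<in>K'. descendants k z')"
    using T' by (auto simp: trapezoid_at_def)
  obtain x a b where x: "a \<in> K" "b \<in> K'" "x \<in> descendants a z" "x \<in> descendants b z'"
    using meet K(2) K'(2) by blast
  have "lev z - int a = lev z' - int b"
    using level_descendants[OF x(3)] level_descendants[OF x(4)] by simp
  with lev have "b \<le> a" by simp
  then have "a = (a - b) + b" by simp
  then have "(parent ^^ a) x = (parent ^^ (a - b)) ((parent ^^ b) x)"
    by (metis comp_apply funpow_add)
  moreover have "z' \<in> V" using T' by (simp add: trapezoid_at_def)
  ultimately have z': "z' \<in> descendants (a - b) z"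
    using x(3,4) by (simp add: descendants_def)
  have "a < 2 * h" using x K by auto
  have below: "y \<in> (\<Union>k<4 * h. descendants k z)" if c: "c \<le> 2 * b" "y \<in> descendants c z'" for y c
  proof -
    have "y \<in> descendants (a - b + c) z" using descendants_trans[OF c(2) z'] .
    \<comment> \<open>From \<open>c \<le> 2 * b\<close> the depth is at most
      \<open>a + b \<le> 2 * a\<close>, and \<open>a < 2 * h\<close>. This is the source of the
      constant 4.\<close>
    moreover have "a - b + c < 4 * h" using \<open>a < 2 * h\<close> \<open>b \<le> a\<close> c(1) by linarith
    ultimately show ?thesis by blast
  qed
  \<comment> \<open>The root is its own descendant of depth \<open>c = 0\<close>.\<close>
  have "z' \<in> (\<Union>k<4 * h. descendants k z)"
    using below[of 0 z'] descendants_0[OF \<open>z' \<in> V\<close>] by simp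
  moreover have "T' \<subseteq> (\<Union>k<4 * h. descendants k z)"
    using below K'(1)[OF x(2)] unfolding K'(2) by blast
  ultimately show ?thesis by simp
qed

end

text \<open>Indices are treated in order of falling rank. One whose set meets a chosen set is
  discarded, and the set it meets has no smaller rank; any other is chosen and, being nonempty,
  meets itself.\<close>

lemma greedy_disjoint_subfamily:
  fixes T :: "'i \<Rightarrow> 'a set" and rank :: "'i \<Rightarrow> int"
  assumes "finite I" "\<And>i. i \<in> I \<Longrightarrow> T i \<noteq> {}"
  shows "\<exists>J\<subseteq>I. disjoint_family_on T J \<and> (\<forall>i\<in>I. \<exists>j\<in>J. rank i \<le> rank j \<and> T j \<inter> T i \<noteq> {})"
  using assms
\<comment> \<open>The rule inserts a largest value last, so the sign makes the new index one of
  lowest rank.\<close>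
proof (induction I rule: finite_ranking_induct[where f = "\<lambda>i. - rank i"])
  case empty
  then show ?case by (auto simp: disjoint_family_on_def)
next
  case (insert i I)
  then obtain J where J: "J \<subseteq> I" "disjoint_family_on T J"
    "\<And>i. i \<in> I \<Longrightarrow> \<exists>j\<in>J. rank i \<le> rank j \<and> T j \<inter> T i \<noteq> {}" by auto
  show ?case
  proof (cases "\<exists>j\<in>J. T j \<inter> T i \<noteq> {}")
    case True
    with insert.hyps(2) J show ?thesis by (intro exI[of _ J]) fastforce
  next
    case False
    then have "disjoint_family_on T (insert i J)"
      using J(2) by (auto simp: disjoint_family_on_def)
    with J insert.prems show ?thesis by (intro exI[of _ "insert i J"]) blast
  qed
qed

text \<open>The norm ranges over families numbered from 1 to \<open>n\<close>, so \<open>J\<close>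
  is enumerated.\<close>

lemma sum_le_set_function_norm:
  assumes "finite J" "disjoint_family_on T J" "\<And>j. j \<in> J \<Longrightarrow> T j \<in> \<Q>"
  shows "(\<Sum>j\<in>J. F (T j)) \<le> set_function_norm \<Q> F"
proof -
  obtain f where f: "bij_betw f {1..card J} J" using ex_bij_betw_nat_finite_1[OF assms(1)] by blast
  have "(\<Sum>j\<in>J. F (T j)) = (\<Sum>i=1..card J. F ((T \<circ> f) i))"
    using sum.reindex_bij_betw[OF f, of "\<lambda>j. F (T j)"] by simp
  moreover have "\<forall>i\<in>{1..card J}. (T \<circ> f) i \<in> \<Q>"
    using f assms(3) by (auto simp: bij_betw_def)
  moreover have "disjoint_family_on (T \<circ> f) {1..card J}"
    unfolding disjoint_family_on_def
  proof (intro ballI impI)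
    fix m n assume "m \<in> {1..card J}" "n \<in> {1..card J}" "m \<noteq> n"
    then have "f m \<in> J" "f n \<in> J" "f m \<noteq> f n"
      using f by (auto simp: bij_betw_def dest: inj_onD)
    then show "(T \<circ> f) m \<inter> (T \<circ> f) n = {}"
      using assms(2) by (simp add: disjoint_family_on_def)
  qed
  ultimately show ?thesis
    unfolding set_function_norm_def by (intro Sup_upper CollectI exI conjI) auto
qed

section \<open>The maximal inequality\<close>

context based_tree
begin

text \<open>The condition \<open>x \<in> insert z T\<close> unites the two families:
  \<open>x\<close> lies in \<open>T\<close> or is its root.\<close>

lemma maximal_inequality:
  assumes Q: "\<And>x T. x \<in> V \<Longrightarrow> T \<in> Q x \<Longrightarrow> \<exists>z h. trapezoid_at z h T \<and> x \<in> insert z T"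
    and r: "0 < r"
  shows "emeasure \<tau> {x \<in> V. ennreal r < maximal_function Q (emeasure \<tau>) F x}
    \<le> ennreal (4 / r) * set_function_norm (\<Union>x\<in>V. Q x) F"
proof (rule emeasure_le_finite_subsets)
  fix K assume K: "finite K" "K \<subseteq> {x \<in> V. ennreal r < maximal_function Q (emeasure \<tau>) F x}"
  have "\<forall>x\<in>K. \<exists>T z h. T \<in> Q x \<and> ennreal r < F T / emeasure \<tau> T \<and> trapezoid_at z h T \<and> x \<in> insert z T"
  proof
    fix x assume "x \<in> K"
    with K(2) have x: "x \<in> V" "ennreal r < (SUP A\<in>Q x. F A / emeasure \<tau> A)"
      by (auto simp: maximal_function_def)
    from x(2) obtain T where T: "T \<in> Q x" "ennreal r < F T / emeasure \<tau> T"
      by (auto simp: less_SUP_iff)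
    with Q[OF x(1) T(1)] show "\<exists>T z h. T \<in> Q x \<and> ennreal r < F T / emeasure \<tau> T \<and> trapezoid_at z h T \<and> x \<in> insert z T"
      by blast
  qed
  then obtain T z h where T: "\<And>x. x \<in> K \<Longrightarrow> T x \<in> Q x"
      "\<And>x. x \<in> K \<Longrightarrow> ennreal r < F (T x) / emeasure \<tau> (T x)"
      "\<And>x. x \<in> K \<Longrightarrow> trapezoid_at (z x) (h x) (T x)"
      "\<And>x. x \<in> K \<Longrightarrow> x \<in> insert (z x) (T x)"
    by metis
  obtain J where J: "J \<subseteq> K" "disjoint_family_on T J"
      "\<And>x. x \<in> K \<Longrightarrow> \<exists>j\<in>J. lev (z x) \<le> lev (z j) \<and> T j \<inter> T x \<noteq> {}"
    using greedy_disjoint_subfamily[OF K(1), of T "\<lambda>x. lev (z x)"] trapezoid_at_nonempty[OF T(3)]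
    by blast
  have "finite J" using J(1) K(1) finite_subset by blast
  \<comment> \<open>These sets cover \<open>K\<close> and have four times the mass of the selected
    trapezoids.\<close>
  define D where "D j = (\<Union>k<4 * h j. descendants k (z j))" for j
  have D_sets: "D j \<in> sets \<tau>" for j
    using descendants_subset by (auto simp: D_def tree_measure_def sets_point_measure)
  have "K \<subseteq> (\<Union>j\<in>J. D j)"
  proof
    fix x assume x: "x \<in> K"
    then obtain j where j: "j \<in> J" "lev (z x) \<le> lev (z j)" "T j \<inter> T x \<noteq> {}" using J(3) by blast
    then have "j \<in> K" using J(1) by blast
    have "insert (z x) (T x) \<subseteq> D j"
      unfolding D_def by (rule overlapping_trapezoids[OF T(3)[OF \<open>j \<in> K\<close>] T(3)[OF x] j(3,2)])
    with T(4)[OF x] j(1) show "x \<in> (\<Union>j\<in>J. D j)" by blast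
  qed
  then have "emeasure \<tau> K \<le> emeasure \<tau> (\<Union>j\<in>J. D j)"
    using D_sets \<open>finite J\<close> by (intro emeasure_mono) auto
  also have "\<dots> \<le> (\<Sum>j\<in>J. emeasure \<tau> (D j))"
    using D_sets \<open>finite J\<close> by (intro emeasure_subadditive_finite) auto
  also have "\<dots> \<le> (\<Sum>j\<in>J. ennreal (4 / r) * F (T j))"
  proof (rule sum_mono)
    fix j assume "j \<in> J"
    then have j: "j \<in> K" using J(1) by blast
    have zV: "z j \<in> V" and h: "h j \<noteq> 0" using T(3)[OF j] by (auto simp: trapezoid_at_def)
    define m where "m = real (h j) * real q powi lev (z j)"
    have m: "m > 0" using h q by (simp add: m_def)
    have Tm: "emeasure \<tau> (T j) = ennreal m"
      using emeasure_trapezoid_at[OF T(3)[OF j]]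
      by (simp add: m_def ennreal_mult ennreal_of_nat_eq_real_of_nat)
    have "emeasure \<tau> (D j) = of_nat (4 * h j) * ennreal (real q powi lev (z j))"
      unfolding D_def using emeasure_generations[OF zV, of "{..<4 * h j}"] by simp
    also have "\<dots> = ennreal (4 * m)"
      unfolding ennreal_of_nat_eq_real_of_nat
      by (subst ennreal_mult[symmetric]) (auto simp: m_def)
    also have "\<dots> = ennreal (4 / r) * (ennreal r * ennreal m)"
      using r m by (simp add: ennreal_mult[symmetric])
    \<comment> \<open>The choice of \<open>T j\<close> gives \<open>r < F (T j) / m\<close>; as
      \<open>m\<close> is positive and finite it cancels afterwards, even if \<open>F (T j)\<close>
      is infinite.\<close>
    also have "ennreal r * ennreal m \<le> F (T j) / ennreal m * ennreal m"
      using T(2)[OF j] Tm by (intro mult_right_mono) auto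
    also have "\<dots> = F (T j)"
      using m by (simp add: ennreal_divide_times ennreal_mult_divide_eq)
    finally show "emeasure \<tau> (D j) \<le> ennreal (4 / r) * F (T j)"
      by (simp add: mult_left_mono)
  qed
  also have "\<dots> = ennreal (4 / r) * (\<Sum>j\<in>J. F (T j))" by (simp add: sum_distrib_left)
  also have "\<dots> \<le> ennreal (4 / r) * set_function_norm (\<Union>x\<in>V. Q x) F"
  proof (intro mult_left_mono sum_le_set_function_norm \<open>finite J\<close> J(2))
    fix j assume "j \<in> J"
    with J(1) have j: "j \<in> K" by blast
    then have "j \<in> V" using K(2) by blast
    with T(1)[OF j] show "T j \<in> (\<Union>x\<in>V. Q x)" by blast
  qed simp
  finally show "emeasure \<tau> K \<le> ennreal (4 / r) * set_function_norm (\<Union>x\<in>V. Q x) F" .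
qed auto

lemma HL_constant_le_4:
  assumes "\<And>x T. x \<in> V \<Longrightarrow> T \<in> Q x \<Longrightarrow> \<exists>z h. trapezoid_at z h T \<and> x \<in> insert z T"
  shows "HL_constant V Q (emeasure \<tau>) \<le> 4"
  unfolding HL_constant_def
  by (rule Inf_lower) (use maximal_inequality[OF assms] in \<open>auto intro!: exI[of _ 4]\<close>)

end

theorem theorem14:
  fixes V :: "'a set" and E :: "'a \<Rightarrow> 'a \<Rightarrow> bool" and q :: nat
    and G :: "'a set" and N :: "'a \<Rightarrow> int"
  assumes "2 \<le> q"
    and "homogeneous_tree V E (q + 1)"
    and "infinite_geodesic V E G"
    and "bij_betw N G UNIV"
    and "\<forall>x\<in>G. \<forall>y\<in>G. int (graph_dist V E x y) = \<bar>N x - N y\<bar>"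
  shows "HL_constant V (trapezoids_containing V E G N) (emeasure (tree_measure V E G N q)) \<le> 4
    \<and> HL_constant V (trapezoids_rooted V E G N) (emeasure (tree_measure V E G N q)) \<le> 4"
proof -
  interpret based_tree V E G N q
    using assms by unfold_locales (auto simp: homogeneous_tree_def infinite_geodesic_def)
  show ?thesis
  proof (intro conjI HL_constant_le_4)
    fix x T assume "x \<in> V" "T \<in> trapezoids_containing V E G N x"
    then show "\<exists>z h. trapezoid_at z h T \<and> x \<in> insert z T"
      using trapezoids_rooted_at unfolding trapezoids_containing_def trapezoids_def by blast
  next
    \<comment> \<open>Here \<open>x\<close> is the root \<open>z\<close>, so it belongs to
      \<open>insert z T\<close> even when \<open>T\<close> does not contain it.\<close>
    fix x T assume "x \<in> V" "T \<in> trapezoids_rooted V E G N x"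
    then show "\<exists>z h. trapezoid_at z h T \<and> x \<in> insert z T"
      using trapezoids_rooted_at by blast
  qed
qed

end
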